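(* Let $\Bbbk$ be a field and let $(H_l)_{l\in I}$ be a family of $2$-Hopf algebras over $\Bbbk$. Let $(B,(q_l:H_l\to B)_{l\in I})$ be the coproduct, in the category ${}_2\mathrm{Bialg}$ of $2$-bialgebras, of the underlying $2$-bialgebras, and let $i:B\to H$, with $H$ a $2$-Hopf algebra and $i$ a morphism of $2$-bialgebras, be a universal arrow from $B$ to the forgetful functor ${}_2\mathrm{Halg}\to{}_2\mathrm{Bialg}$. Then $(H,(i\circ q_l)_{l\in I})$ is the coproduct of the family $(H_l)_{l\in I}$ in the category ${}_2\mathrm{Halg}$ of $2$-Hopf algebras. The same holds for cocommutative $2$-Hopf algebras, with ${}_2\mathrm{Bialg}$ and ${}_2\mathrm{Halg}$ replaced by ${}_2\mathrm{Bialg}^{coc}$ and ${}_2\mathrm{Halg}^{coc}$ throughout.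
   Context: All structures are linear over a field $\Bbbk$; algebras are unital and associative, coalgebras counital and coassociative. A $2$-bialgebra is a coalgebra equipped with two algebra structures sharing the same unit, such that the unit and both multiplications are coalgebra maps; morphisms are the coalgebra maps that are algebra morphisms for both structures. A $2$-Hopf algebra is a $2$-bialgebra both of whose bialgebra structures have antipodes; morphisms are the morphisms of $2$-bialgebras. The superscript "coc" denotes the full subcategory of objects whose underlying coalgebra is cocommutative. A universal arrow from $B$ to a functor $U:\mathcal D\to\mathcal C$ is a pair $(H,i:B\to UH)$ such that every morphism $B\to UL$ with $L\in\mathcal D$ factors as $U(f)\circ i$ for a unique morphism $f:H\to L$ in $\mathcal D$. The coproducts and universal arrows used here exist. *)

theory Defs
  imports "HOL-Algebra.Module" "HOL-Algebra.AbelCoset"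
begin

section \<open>Linear algebra over a field K: tensor products\<close>

text \<open>Vector spaces are HOL-Algebra modules over a field \<open>K\<close>.  The record type
  \<^type>\<open>module_ext\<close> extends rings, so a vector space always carries fields \<open>mult\<close> and \<open>one\<close>;
  the locale \<^locale>\<open>module\<close> ignores them.\<close>

definition linear_map ::
  "('k, 'c) ring_scheme \<Rightarrow> ('k, 'a, 'r) module_scheme \<Rightarrow> ('k, 'b, 's) module_scheme \<Rightarrow> ('a \<Rightarrow> 'b) \<Rightarrow> bool"
  where "linear_map K V W f \<longleftrightarrow>
    f \<in> carrier V \<rightarrow> carrier W \<and>
    (\<forall>x\<in>carrier V. \<forall>y\<in>carrier V. f (x \<oplus>\<^bsub>V\<^esub> y) = f x \<oplus>\<^bsub>W\<^esub> f y) \<and>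
    (\<forall>c\<in>carrier K. \<forall>x\<in>carrier V. f (c \<odot>\<^bsub>V\<^esub> x) = c \<odot>\<^bsub>W\<^esub> f x)"

definition ground_module :: "('k, 'c) ring_scheme \<Rightarrow> ('k, 'k) module"
  where "ground_module K =
    \<lparr>carrier = carrier K, mult = mult K, one = one K, zero = zero K, add = add K, smult = mult K\<rparr>"

definition free_module :: "('k, 'c) ring_scheme \<Rightarrow> 's set \<Rightarrow> ('k, 's \<Rightarrow> 'k) module"
  where "free_module K S =
    \<lparr>carrier = {u. (\<forall>s\<in>S. u s \<in> carrier K) \<and> (\<forall>s. s \<notin> S \<longrightarrow> u s = \<zero>\<^bsub>K\<^esub>) \<and> finite {s. u s \<noteq> \<zero>\<^bsub>K\<^esub>}},
     mult = undefined, one = undefined,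
     zero = (\<lambda>s. \<zero>\<^bsub>K\<^esub>), add = (\<lambda>u v s. u s \<oplus>\<^bsub>K\<^esub> v s), smult = (\<lambda>c u s. c \<otimes>\<^bsub>K\<^esub> u s)\<rparr>"

definition free_gen :: "('k, 'c) ring_scheme \<Rightarrow> 's \<Rightarrow> ('s \<Rightarrow> 'k)"
  where "free_gen K s = (\<lambda>t. if t = s then \<one>\<^bsub>K\<^esub> else \<zero>\<^bsub>K\<^esub>)"

definition generated_submodule ::
  "('k, 'c) ring_scheme \<Rightarrow> ('k, 'a, 'r) module_scheme \<Rightarrow> 'a set \<Rightarrow> 'a set"
  where "generated_submodule K V S = \<Inter> {N. submodule N K V \<and> S \<subseteq> N}"

definition quotient_module ::
  "('k, 'c) ring_scheme \<Rightarrow> ('k, 'a, 'r) module_scheme \<Rightarrow> 'a set \<Rightarrow> ('k, 'a set) module"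
  where "quotient_module K V N =
    \<lparr>carrier = a_rcosets\<^bsub>V\<^esub> N, mult = undefined, one = undefined,
     zero = N, add = set_add V, smult = (\<lambda>c T. \<Union>u\<in>T. N +>\<^bsub>V\<^esub> (c \<odot>\<^bsub>V\<^esub> u))\<rparr>"

definition bilinear_relations ::
  "('k, 'c) ring_scheme \<Rightarrow> ('k, 'a, 'r) module_scheme \<Rightarrow> ('k, 'b, 's) module_scheme \<Rightarrow> ('a \<times> 'b \<Rightarrow> 'k) set"
  where "bilinear_relations K V W =
    (let F = free_module K (carrier V \<times> carrier W); e = (\<lambda>x y. free_gen K (x, y)) in
      {e (x \<oplus>\<^bsub>V\<^esub> x') y \<ominus>\<^bsub>F\<^esub> (e x y \<oplus>\<^bsub>F\<^esub> e x' y) | x x' y.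
         x \<in> carrier V \<and> x' \<in> carrier V \<and> y \<in> carrier W} \<union>
      {e x (y \<oplus>\<^bsub>W\<^esub> y') \<ominus>\<^bsub>F\<^esub> (e x y \<oplus>\<^bsub>F\<^esub> e x y') | x y y'.
         x \<in> carrier V \<and> y \<in> carrier W \<and> y' \<in> carrier W} \<union>
      {e (c \<odot>\<^bsub>V\<^esub> x) y \<ominus>\<^bsub>F\<^esub> (c \<odot>\<^bsub>F\<^esub> e x y) | c x y.
         c \<in> carrier K \<and> x \<in> carrier V \<and> y \<in> carrier W} \<union>
      {e x (c \<odot>\<^bsub>W\<^esub> y) \<ominus>\<^bsub>F\<^esub> (c \<odot>\<^bsub>F\<^esub> e x y) | c x y.
         c \<in> carrier K \<and> x \<in> carrier V \<and> y \<in> carrier W})"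

definition tensor_kernel ::
  "('k, 'c) ring_scheme \<Rightarrow> ('k, 'a, 'r) module_scheme \<Rightarrow> ('k, 'b, 's) module_scheme \<Rightarrow> ('a \<times> 'b \<Rightarrow> 'k) set"
  where "tensor_kernel K V W =
    generated_submodule K (free_module K (carrier V \<times> carrier W)) (bilinear_relations K V W)"

definition tensor ::
  "('k, 'c) ring_scheme \<Rightarrow> ('k, 'a, 'r) module_scheme \<Rightarrow> ('k, 'b, 's) module_scheme \<Rightarrow>
    ('k, ('a \<times> 'b \<Rightarrow> 'k) set) module"
  where "tensor K V W =
    quotient_module K (free_module K (carrier V \<times> carrier W)) (tensor_kernel K V W)"

definition pure_tensor ::
  "('k, 'c) ring_scheme \<Rightarrow> ('k, 'a, 'r) module_scheme \<Rightarrow> ('k, 'b, 's) module_scheme \<Rightarrow>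
    'a \<Rightarrow> 'b \<Rightarrow> ('a \<times> 'b \<Rightarrow> 'k) set"
  where "pure_tensor K V W x y =
    tensor_kernel K V W +>\<^bsub>free_module K (carrier V \<times> carrier W)\<^esub> free_gen K (x, y)"

text \<open>The linear map from a tensor product to \<open>M\<close> induced by a bilinear map \<open>\<beta>\<close>; its value at a
  coset does not depend on the chosen representative \<open>u\<close>.\<close>

definition tensor_lift ::
  "('k, 'c) ring_scheme \<Rightarrow> ('k, 'm, 'r) module_scheme \<Rightarrow> ('a \<Rightarrow> 'b \<Rightarrow> 'm) \<Rightarrow> ('a \<times> 'b \<Rightarrow> 'k) set \<Rightarrow> 'm"
  where "tensor_lift K M \<beta> T =
    (let u = (SOME u. u \<in> T) in
      (\<Oplus>\<^bsub>M\<^esub>p\<in>{p. u p \<noteq> \<zero>\<^bsub>K\<^esub>}. u p \<odot>\<^bsub>M\<^esub> \<beta> (fst p) (snd p)))"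

text \<open>\<open>tensor_map K V W f g\<close> is \<open>f \<otimes> g\<close>, where \<open>V\<close> and \<open>W\<close> are the codomains of \<open>f\<close> and \<open>g\<close>.\<close>

definition tensor_map ::
  "('k, 'c) ring_scheme \<Rightarrow> ('k, 'v, 'r) module_scheme \<Rightarrow> ('k, 'w, 's) module_scheme \<Rightarrow>
    ('a \<Rightarrow> 'v) \<Rightarrow> ('b \<Rightarrow> 'w) \<Rightarrow> ('a \<times> 'b \<Rightarrow> 'k) set \<Rightarrow> ('v \<times> 'w \<Rightarrow> 'k) set"
  where "tensor_map K V W f g =
    tensor_lift K (tensor K V W) (\<lambda>x y. pure_tensor K V W (f x) (g y))"

definition tensor_swap ::
  "('k, 'c) ring_scheme \<Rightarrow> ('k, 'v, 'r) module_scheme \<Rightarrow> ('k, 'w, 's) module_scheme \<Rightarrow>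
    ('v \<times> 'w \<Rightarrow> 'k) set \<Rightarrow> ('w \<times> 'v \<Rightarrow> 'k) set"
  where "tensor_swap K V W =
    tensor_lift K (tensor K W V) (\<lambda>x y. pure_tensor K W V y x)"

text \<open>The canonical map \<open>(U \<otimes> V) \<otimes> W \<rightarrow> U \<otimes> (V \<otimes> W)\<close>.\<close>

definition tensor_assoc ::
  "('k, 'c) ring_scheme \<Rightarrow> ('k, 'u, 'q) module_scheme \<Rightarrow> ('k, 'v, 'r) module_scheme \<Rightarrow>
    ('k, 'w, 's) module_scheme \<Rightarrow>
    (('u \<times> 'v \<Rightarrow> 'k) set \<times> 'w \<Rightarrow> 'k) set \<Rightarrow> ('u \<times> ('v \<times> 'w \<Rightarrow> 'k) set \<Rightarrow> 'k) set"
  where "tensor_assoc K U V W =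
    (let M = tensor K U (tensor K V W) in
      tensor_lift K M (\<lambda>t z.
        tensor_lift K M (\<lambda>x y. pure_tensor K U (tensor K V W) x (pure_tensor K V W y z)) t))"

text \<open>The canonical map \<open>(V \<otimes> V') \<otimes> (W \<otimes> W') \<rightarrow> (V \<otimes> W) \<otimes> (V' \<otimes> W')\<close>.\<close>

definition tensor_interchange ::
  "('k, 'c) ring_scheme \<Rightarrow> ('k, 'v, 'p) module_scheme \<Rightarrow> ('k, 'v', 'q) module_scheme \<Rightarrow>
    ('k, 'w, 'r) module_scheme \<Rightarrow> ('k, 'w', 's) module_scheme \<Rightarrow>
    (('v \<times> 'v' \<Rightarrow> 'k) set \<times> ('w \<times> 'w' \<Rightarrow> 'k) set \<Rightarrow> 'k) set \<Rightarrow>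
    (('v \<times> 'w \<Rightarrow> 'k) set \<times> ('v' \<times> 'w' \<Rightarrow> 'k) set \<Rightarrow> 'k) set"
  where "tensor_interchange K V V' W W' =
    (let M = tensor K (tensor K V W) (tensor K V' W') in
      tensor_lift K M (\<lambda>s t.
        tensor_lift K M (\<lambda>x x'.
          tensor_lift K M (\<lambda>y y'.
            pure_tensor K (tensor K V W) (tensor K V' W')
              (pure_tensor K V W x y) (pure_tensor K V' W' x' y')) t) s))"

section \<open>Algebras, coalgebras, bialgebras\<close>

text \<open>The library locale \<^locale>\<open>algebra\<close> is restricted to commutative algebras.\<close>

definition unital_algebra :: "('k, 'c) ring_scheme \<Rightarrow> ('k, 'a, 'r) module_scheme \<Rightarrow> bool"
  where "unital_algebra K A \<longleftrightarrow> module K A \<and> ring A \<and>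
    (\<forall>c\<in>carrier K. \<forall>x\<in>carrier A. \<forall>y\<in>carrier A.
      (c \<odot>\<^bsub>A\<^esub> x) \<otimes>\<^bsub>A\<^esub> y = c \<odot>\<^bsub>A\<^esub> (x \<otimes>\<^bsub>A\<^esub> y) \<and>
      x \<otimes>\<^bsub>A\<^esub> (c \<odot>\<^bsub>A\<^esub> y) = c \<odot>\<^bsub>A\<^esub> (x \<otimes>\<^bsub>A\<^esub> y))"

definition algebra_hom ::
  "('k, 'c) ring_scheme \<Rightarrow> ('k, 'a, 'r) module_scheme \<Rightarrow> ('k, 'b, 's) module_scheme \<Rightarrow> ('a \<Rightarrow> 'b) \<Rightarrow> bool"
  where "algebra_hom K A B f \<longleftrightarrow> linear_map K A B f \<and>
    f \<one>\<^bsub>A\<^esub> = \<one>\<^bsub>B\<^esub> \<and>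
    (\<forall>x\<in>carrier A. \<forall>y\<in>carrier A. f (x \<otimes>\<^bsub>A\<^esub> y) = f x \<otimes>\<^bsub>B\<^esub> f y)"

definition unit_map :: "('k, 'a, 'r) module_scheme \<Rightarrow> 'k \<Rightarrow> 'a"
  where "unit_map A c = c \<odot>\<^bsub>A\<^esub> \<one>\<^bsub>A\<^esub>"

definition mult_map ::
  "('k, 'c) ring_scheme \<Rightarrow> ('k, 'a, 'r) module_scheme \<Rightarrow> ('a \<times> 'a \<Rightarrow> 'k) set \<Rightarrow> 'a"
  where "mult_map K A = tensor_lift K A (\<lambda>x y. x \<otimes>\<^bsub>A\<^esub> y)"

record ('k, 'a) coalgebra = "('k, 'a) module" +
  comult :: "'a \<Rightarrow> ('a \<times> 'a \<Rightarrow> 'k) set"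
  counit :: "'a \<Rightarrow> 'k"

text \<open>Counitality is stated after identifying \<open>K \<otimes> C\<close> and \<open>C \<otimes> K\<close> with \<open>C\<close> by scalar
  multiplication.\<close>

definition is_coalgebra :: "('k, 'c) ring_scheme \<Rightarrow> ('k, 'a, 'r) coalgebra_scheme \<Rightarrow> bool"
  where "is_coalgebra K C \<longleftrightarrow> module K C \<and>
    linear_map K C (tensor K C C) (comult C) \<and>
    linear_map K C (ground_module K) (counit C) \<and>
    (\<forall>x\<in>carrier C.
      tensor_assoc K C C C (tensor_map K (tensor K C C) C (comult C) (\<lambda>y. y) (comult C x)) =
        tensor_map K C (tensor K C C) (\<lambda>y. y) (comult C) (comult C x) \<and>
      tensor_lift K C (\<lambda>c y. c \<odot>\<^bsub>C\<^esub> y)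
        (tensor_map K (ground_module K) C (counit C) (\<lambda>y. y) (comult C x)) = x \<and>
      tensor_lift K C (\<lambda>y c. c \<odot>\<^bsub>C\<^esub> y)
        (tensor_map K C (ground_module K) (\<lambda>y. y) (counit C) (comult C x)) = x)"

definition cocommutative :: "('k, 'c) ring_scheme \<Rightarrow> ('k, 'a, 'r) coalgebra_scheme \<Rightarrow> bool"
  where "cocommutative K C \<longleftrightarrow>
    (\<forall>x\<in>carrier C. tensor_swap K C C (comult C x) = comult C x)"

definition coalgebra_hom ::
  "('k, 'c) ring_scheme \<Rightarrow> ('k, 'a, 'r) coalgebra_scheme \<Rightarrow> ('k, 'b, 's) coalgebra_scheme \<Rightarrow>
    ('a \<Rightarrow> 'b) \<Rightarrow> bool"
  where "coalgebra_hom K C D f \<longleftrightarrow> linear_map K C D f \<and>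
    (\<forall>x\<in>carrier C. comult D (f x) = tensor_map K D D f f (comult C x) \<and>
      counit D (f x) = counit C x)"

definition ground_coalgebra :: "('k, 'c) ring_scheme \<Rightarrow> ('k, 'k) coalgebra"
  where "ground_coalgebra K = module.extend (ground_module K)
    (coalgebra.fields
      (\<lambda>c. pure_tensor K (ground_module K) (ground_module K) c \<one>\<^bsub>K\<^esub>)
      (\<lambda>c. c))"

definition tensor_coalgebra ::
  "('k, 'c) ring_scheme \<Rightarrow> ('k, 'a, 'r) coalgebra_scheme \<Rightarrow> ('k, 'b, 's) coalgebra_scheme \<Rightarrow>
    ('k, ('a \<times> 'b \<Rightarrow> 'k) set) coalgebra"
  where "tensor_coalgebra K C D = module.extend (tensor K C D)
    (coalgebra.fields
      (\<lambda>t. tensor_interchange K C C D D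
        (tensor_map K (tensor K C C) (tensor K D D) (comult C) (comult D) t))
      (tensor_lift K (ground_module K) (\<lambda>x y. counit C x \<otimes>\<^bsub>K\<^esub> counit D y)))"

definition is_bialgebra :: "('k, 'c) ring_scheme \<Rightarrow> ('k, 'a, 'r) coalgebra_scheme \<Rightarrow> bool"
  where "is_bialgebra K A \<longleftrightarrow> unital_algebra K A \<and> is_coalgebra K A \<and>
    coalgebra_hom K (ground_coalgebra K) A (unit_map A) \<and>
    coalgebra_hom K (tensor_coalgebra K A A) A (mult_map K A)"

definition is_antipode ::
  "('k, 'c) ring_scheme \<Rightarrow> ('k, 'a, 'r) coalgebra_scheme \<Rightarrow> ('a \<Rightarrow> 'a) \<Rightarrow> bool"
  where "is_antipode K A S \<longleftrightarrow> linear_map K A A S \<and>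
    (\<forall>x\<in>carrier A.
      mult_map K A (tensor_map K A A S (\<lambda>y. y) (comult A x)) = unit_map A (counit A x) \<and>
      mult_map K A (tensor_map K A A (\<lambda>y. y) S (comult A x)) = unit_map A (counit A x))"

section \<open>2-bialgebras and 2-Hopf algebras\<close>

text \<open>The first multiplication is the field \<open>mult\<close>; the common unit is the field \<open>one\<close>.\<close>

record ('k, 'a) two_bialgebra = "('k, 'a) coalgebra" +
  mult2 :: "'a \<Rightarrow> 'a \<Rightarrow> 'a"

definition second :: "('k, 'a) two_bialgebra \<Rightarrow> ('k, 'a) two_bialgebra"
  where "second A = A\<lparr>mult := mult2 A\<rparr>"

definition is_two_bialgebra :: "('k, 'c) ring_scheme \<Rightarrow> ('k, 'a) two_bialgebra \<Rightarrow> bool"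
  where "is_two_bialgebra K A \<longleftrightarrow> is_bialgebra K A \<and> is_bialgebra K (second A)"

definition is_two_hopf :: "('k, 'c) ring_scheme \<Rightarrow> ('k, 'a) two_bialgebra \<Rightarrow> bool"
  where "is_two_hopf K A \<longleftrightarrow> is_two_bialgebra K A \<and>
    (\<exists>S. is_antipode K A S) \<and> (\<exists>S. is_antipode K (second A) S)"

text \<open>Morphisms are extensional functions, so that equality of morphisms is equality in HOL.\<close>

definition two_bialgebra_hom ::
  "('k, 'c) ring_scheme \<Rightarrow> ('k, 'a) two_bialgebra \<Rightarrow> ('k, 'a) two_bialgebra \<Rightarrow> ('a \<Rightarrow> 'a) set"
  where "two_bialgebra_hom K A B =
    {f \<in> extensional (carrier A). coalgebra_hom K A B f \<and>
      algebra_hom K A B f \<and> algebra_hom K (second A) (second B) f}"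

section \<open>Categories, coproducts, universal arrows\<close>

record ('o, 'm) category =
  Obj :: "'o set"
  Hom :: "'o \<Rightarrow> 'o \<Rightarrow> 'm set"
  Id :: "'o \<Rightarrow> 'm"
  Comp :: "'o \<Rightarrow> 'o \<Rightarrow> 'o \<Rightarrow> 'm \<Rightarrow> 'm \<Rightarrow> 'm"
    \<comment> \<open>\<open>Comp C X Y Z g f\<close> is \<open>g \<circ> f\<close> for \<open>f : X \<rightarrow> Y\<close> and \<open>g : Y \<rightarrow> Z\<close>\<close>

definition full_subcategory :: "('o, 'm) category \<Rightarrow> ('o \<Rightarrow> bool) \<Rightarrow> ('o, 'm) category"
  where "full_subcategory C P = C\<lparr>Obj := {X \<in> Obj C. P X}\<rparr>"

record ('o1, 'm1, 'o2, 'm2) cat_functor =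
  fobj :: "'o1 \<Rightarrow> 'o2"
  fmor :: "'m1 \<Rightarrow> 'm2"

definition is_coproduct ::
  "('o, 'm) category \<Rightarrow> 'i set \<Rightarrow> ('i \<Rightarrow> 'o) \<Rightarrow> 'o \<Rightarrow> ('i \<Rightarrow> 'm) \<Rightarrow> bool"
  where "is_coproduct C I X P q \<longleftrightarrow>
    (\<forall>l\<in>I. X l \<in> Obj C) \<and> P \<in> Obj C \<and> (\<forall>l\<in>I. q l \<in> Hom C (X l) P) \<and>
    (\<forall>Y\<in>Obj C. \<forall>f. (\<forall>l\<in>I. f l \<in> Hom C (X l) Y) \<longrightarrow>
      (\<exists>!h. h \<in> Hom C P Y \<and> (\<forall>l\<in>I. Comp C (X l) P Y h (q l) = f l)))"

definition universal_arrow ::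
  "('o1, 'm1) category \<Rightarrow> ('o2, 'm2) category \<Rightarrow> ('o1, 'm1, 'o2, 'm2) cat_functor \<Rightarrow>
    'o2 \<Rightarrow> 'o1 \<Rightarrow> 'm2 \<Rightarrow> bool"
  where "universal_arrow D C U B H i \<longleftrightarrow>
    B \<in> Obj C \<and> H \<in> Obj D \<and> i \<in> Hom C B (fobj U H) \<and>
    (\<forall>L\<in>Obj D. \<forall>g\<in>Hom C B (fobj U L).
      (\<exists>!f. f \<in> Hom D H L \<and> Comp C B (fobj U H) (fobj U L) (fmor U f) i = g))"

text \<open>The category of 2-bialgebras whose carriers are subsets of the type \<open>'a\<close>, which plays the
  role of a universe.\<close>

definition two_Bialg ::
  "('k, 'c) ring_scheme \<Rightarrow> (('k, 'a) two_bialgebra, 'a \<Rightarrow> 'a) category"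
  where "two_Bialg K =
    \<lparr>Obj = {A. is_two_bialgebra K A},
     Hom = two_bialgebra_hom K,
     Id = (\<lambda>A. restrict id (carrier A)),
     Comp = (\<lambda>A B C g f. compose (carrier A) g f)\<rparr>"

definition two_Halg ::
  "('k, 'c) ring_scheme \<Rightarrow> (('k, 'a) two_bialgebra, 'a \<Rightarrow> 'a) category"
  where "two_Halg K =
    \<lparr>Obj = {A. is_two_hopf K A},
     Hom = two_bialgebra_hom K,
     Id = (\<lambda>A. restrict id (carrier A)),
     Comp = (\<lambda>A B C g f. compose (carrier A) g f)\<rparr>"

definition two_Bialg_coc ::
  "('k, 'c) ring_scheme \<Rightarrow> (('k, 'a) two_bialgebra, 'a \<Rightarrow> 'a) category"
  where "two_Bialg_coc K = full_subcategory (two_Bialg K) (cocommutative K)"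

definition two_Halg_coc ::
  "('k, 'c) ring_scheme \<Rightarrow> (('k, 'a) two_bialgebra, 'a \<Rightarrow> 'a) category"
  where "two_Halg_coc K = full_subcategory (two_Halg K) (cocommutative K)"

text \<open>Having antipodes is a property of a 2-bialgebra, so the forgetful functors are
  inclusions.\<close>

definition forgetful ::
  "(('k, 'a) two_bialgebra, 'a \<Rightarrow> 'a, ('k, 'a) two_bialgebra, 'a \<Rightarrow> 'a) cat_functor"
  where "forgetful = \<lparr>fobj = (\<lambda>A. A), fmor = (\<lambda>f. f)\<rparr>"

end

theory Submission
  imports Defs
begin

text \<open>Left adjoints preserve coproducts: a cocone from the \<open>Hs l\<close> to a 2-Hopf algebra \<open>Y\<close>
  extends uniquely along \<open>q\<close> to \<open>B \<rightarrow> Y\<close>, and this extends uniquely along \<open>i\<close> to \<open>H \<rightarrow> Y\<close>.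
  Everything that is not formal lies in the fact that composites of morphisms are morphisms, which
  for comultiplications is the functoriality
  \<open>(g \<otimes> g') \<circ> (f \<otimes> f') = (g \<circ> f) \<otimes> (g' \<circ> f')\<close>.  It follows from the universal property of
  the tensor product, which needs in particular that \<^const>\<open>tensor_lift\<close> does not depend on the
  representative chosen by \<open>SOME\<close>.\<close>

section \<open>Linear maps and free modules\<close>

text \<open>The linear extension of \<open>h\<close> from the generators to the free module. It has
  the shape of the sum in \<open>tensor_lift\<close>, with the vector \<open>u\<close> as an
  argument instead of a representative picked by \<open>SOME\<close>. The index set is not an
  argument, since a vector of the free module carries its own finite support.\<close>

definition free_lift ::
  "('k, 'c) ring_scheme \<Rightarrow> ('k, 'm, 'r) module_scheme \<Rightarrow> ('s \<Rightarrow> 'm) \<Rightarrow> ('s \<Rightarrow> 'k) \<Rightarrow> 'm"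
  where "free_lift K M h u = (\<Oplus>\<^bsub>M\<^esub>p\<in>{p. u p \<noteq> \<zero>\<^bsub>K\<^esub>}. u p \<odot>\<^bsub>M\<^esub> h p)"

lemma linear_map_closed: "linear_map K V W f \<Longrightarrow> x \<in> carrier V \<Longrightarrow> f x \<in> carrier W"
  unfolding linear_map_def by auto

lemma linear_map_add:
  "linear_map K V W f \<Longrightarrow> x \<in> carrier V \<Longrightarrow> y \<in> carrier V \<Longrightarrow>
    f (x \<oplus>\<^bsub>V\<^esub> y) = f x \<oplus>\<^bsub>W\<^esub> f y"
  unfolding linear_map_def by auto

lemma linear_map_smult:
  "linear_map K V W f \<Longrightarrow> c \<in> carrier K \<Longrightarrow> x \<in> carrier V \<Longrightarrow> f (c \<odot>\<^bsub>V\<^esub> x) = c \<odot>\<^bsub>W\<^esub> f x"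
  unfolding linear_map_def by auto

lemma linear_map_abelian_group_hom:
  assumes "module K V" "module K W" "linear_map K V W f"
  shows "abelian_group_hom V W f"
proof -
  interpret V: module K V by fact
  interpret W: module K W by fact
  show ?thesis using assms(3) unfolding linear_map_def
    by (intro abelian_group_homI group_hom.intro group_hom_axioms.intro V.abelian_group_axioms
        W.abelian_group_axioms V.a_group W.a_group) (auto simp: hom_def)
qed

lemma linear_map_finsum:
  assumes "module K V" "module K W" "linear_map K V W f" "finite A" "g \<in> A \<rightarrow> carrier V"
  shows "f (\<Oplus>\<^bsub>V\<^esub>a\<in>A. g a) = (\<Oplus>\<^bsub>W\<^esub>a\<in>A. f (g a))"
proof -
  interpret abelian_group_hom V W f
    using assms linear_map_abelian_group_hom by blast
  show ?thesis using assms(4,5)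
    by (induction A rule: finite_induct) (auto simp: Pi_iff)
qed

lemma linear_map_comp:
  "linear_map K U V f \<Longrightarrow> linear_map K V W g \<Longrightarrow> linear_map K U W (\<lambda>x. g (f x))"
  unfolding linear_map_def by (auto simp: Pi_iff)

text \<open>In a module, sums and scalar multiples stay in the carrier, where \<open>h\<close> and
  \<open>f\<close> agree. This carries linearity over to composites restricted by
  \<open>compose\<close>.\<close>

lemma linear_map_cong:
  assumes "module K V" "linear_map K V W f" "\<And>x. x \<in> carrier V \<Longrightarrow> h x = f x"
  shows "linear_map K V W h"
proof -
  interpret module K V by fact
  show ?thesis using assms(2,3) unfolding linear_map_def by auto
qed

section \<open>Free modules and linear extension from generators\<close>

lemma carrier_free_module:
  assumes "cring K"
  shows "u \<in> carrier (free_module K S) \<longleftrightarrow>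
    (\<forall>s. u s \<in> carrier K) \<and> {s. u s \<noteq> \<zero>\<^bsub>K\<^esub>} \<subseteq> S \<and> finite {s. u s \<noteq> \<zero>\<^bsub>K\<^esub>}"
proof -
  interpret cring K by fact
  show ?thesis unfolding free_module_def by simp (metis (mono_tags, lifting) mem_Collect_eq subset_iff zero_closed)
qed

lemma free_module_sel [simp]:
  "\<zero>\<^bsub>free_module K S\<^esub> = (\<lambda>s. \<zero>\<^bsub>K\<^esub>)"
  "u \<oplus>\<^bsub>free_module K S\<^esub> v = (\<lambda>s. u s \<oplus>\<^bsub>K\<^esub> v s)"
  "c \<odot>\<^bsub>free_module K S\<^esub> u = (\<lambda>s. c \<otimes>\<^bsub>K\<^esub> u s)"
  by (simp_all add: free_module_def)

lemma free_module_module: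
  assumes "cring K"
  shows "module K (free_module K S)"
proof -
  interpret K: cring K by fact
  note car = carrier_free_module[OF assms]
  have fin: "finite {s. u s \<oplus>\<^bsub>K\<^esub> v s \<noteq> \<zero>\<^bsub>K\<^esub>}"
    if "finite {s. u s \<noteq> \<zero>\<^bsub>K\<^esub>}" "finite {s. v s \<noteq> \<zero>\<^bsub>K\<^esub>}" for u v :: "_ \<Rightarrow> _"
    by (rule finite_subset[OF _ finite_UnI[OF that]]) auto
  have fin': "finite {s. c \<otimes>\<^bsub>K\<^esub> u s \<noteq> \<zero>\<^bsub>K\<^esub>}"
    if "finite {s. u s \<noteq> \<zero>\<^bsub>K\<^esub>}" "c \<in> carrier K" for c and u :: "_ \<Rightarrow> _"
    by (rule finite_subset[OF _ that(1)]) (use that(2) in auto)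
  show ?thesis
  proof (rule moduleI)
    show "abelian_group (free_module K S)"
    proof (rule abelian_groupI)
      fix u assume u: "u \<in> carrier (free_module K S)"
      have "(\<lambda>s. \<ominus>\<^bsub>K\<^esub> u s) \<in> carrier (free_module K S)"
      proof -
        \<comment> \<open>Negation leaves the support unchanged, so its finiteness and its inclusion
          in \<open>S\<close> carry over.\<close>
        have "\<ominus>\<^bsub>K\<^esub> u s = \<zero>\<^bsub>K\<^esub> \<longleftrightarrow> u s = \<zero>\<^bsub>K\<^esub>" for s
          using u by (metis car K.minus_minus K.minus_zero)
        then show ?thesis using u unfolding car by simp
      qed
      moreover have "(\<lambda>s. \<ominus>\<^bsub>K\<^esub> u s) \<oplus>\<^bsub>free_module K S\<^esub> u = \<zero>\<^bsub>free_module K S\<^esub>"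
        using u unfolding car by (auto simp: K.l_neg)
      ultimately show "\<exists>v\<in>carrier (free_module K S). v \<oplus>\<^bsub>free_module K S\<^esub> u = \<zero>\<^bsub>free_module K S\<^esub>"
        by blast
    next
      fix u v assume "u \<in> carrier (free_module K S)" "v \<in> carrier (free_module K S)"
      moreover have "{s. u s \<oplus>\<^bsub>K\<^esub> v s \<noteq> \<zero>\<^bsub>K\<^esub>} \<subseteq> {s. u s \<noteq> \<zero>\<^bsub>K\<^esub>} \<union> {s. v s \<noteq> \<zero>\<^bsub>K\<^esub>}"
        by auto
      ultimately show "u \<oplus>\<^bsub>free_module K S\<^esub> v \<in> carrier (free_module K S)"
        unfolding car by (simp add: fin) blast
    qed (auto simp: car K.a_ac)
  next
    fix c u assume "c \<in> carrier K" "u \<in> carrier (free_module K S)"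
    then show "c \<odot>\<^bsub>free_module K S\<^esub> u \<in> carrier (free_module K S)"
      unfolding car by (auto simp: fin')
  qed (auto simp: car assms K.l_distr K.r_distr K.m_assoc)
qed

lemma free_gen_closed:
  assumes "cring K" "s \<in> S"
  shows "free_gen K s \<in> carrier (free_module K S)"
proof -
  interpret cring K by fact
  show ?thesis
    using assms(2) unfolding carrier_free_module[OF assms(1)]
    by (auto simp: free_gen_def intro: finite_subset[of _ "{s}"])
qed

text \<open>Terms outside the support are multiples by zero and add nothing. Vectors with different
  supports can therefore be compared as sums over one common finite set.\<close>

lemma free_lift_superset:
  assumes "module K M" "h \<in> S \<rightarrow> carrier M" "u \<in> carrier (free_module K S)"
    "finite A" "{p. u p \<noteq> \<zero>\<^bsub>K\<^esub>} \<subseteq> A" "A \<subseteq> S"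
  shows "free_lift K M h u = (\<Oplus>\<^bsub>M\<^esub>p\<in>A. u p \<odot>\<^bsub>M\<^esub> h p)"
proof -
  interpret module K M by fact
  note car = carrier_free_module[OF R.is_cring]
  show ?thesis unfolding free_lift_def
    by (rule M.add.finprod_mono_neutral_cong_left) (use assms in \<open>auto simp: car Pi_iff subset_iff\<close>)
qed

lemma free_lift_gen:
  assumes "module K M" "h \<in> S \<rightarrow> carrier M" "s \<in> S"
  shows "free_lift K M h (free_gen K s) = h s"
proof -
  interpret module K M by fact
  \<comment> \<open>Summing over \<open>{s}\<close> instead of the support avoids asking whether one
    and zero differ in \<open>K\<close>.\<close>
  have "free_lift K M h (free_gen K s) = (\<Oplus>\<^bsub>M\<^esub>p\<in>{s}. free_gen K s p \<odot>\<^bsub>M\<^esub> h p)"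
    by (rule free_lift_superset[OF assms(1,2) free_gen_closed[OF R.is_cring assms(3)]])
      (use assms in \<open>auto simp: free_gen_def\<close>)
  then show ?thesis using assms(2,3) by (auto simp: free_gen_def Pi_iff)
qed

text \<open>A linear map commutes with finite linear combinations. In \<open>tensor_map_comp\<close>
  this moves the second tensor map inside the sum that computes the first.\<close>

lemma linear_map_free_lift:
  assumes "module K M" "module K N" "linear_map K M N f"
    and "h \<in> S \<rightarrow> carrier M" "u \<in> carrier (free_module K S)"
  shows "f (free_lift K M h u) = free_lift K N (\<lambda>s. f (h s)) u"
proof -
  interpret M: module K M by fact
  interpret N: module K N by fact
  note car = carrier_free_module[OF M.R.is_cring]
  have h: "h s \<in> carrier M" if "s \<in> S" for s using that assms(4) by auto
  note f = linear_map_closed[OF assms(3)]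
  have "f (free_lift K M h u) = (\<Oplus>\<^bsub>N\<^esub>p\<in>{p. u p \<noteq> \<zero>\<^bsub>K\<^esub>}. f (u p \<odot>\<^bsub>M\<^esub> h p))"
    unfolding free_lift_def
    by (rule linear_map_finsum[OF assms(1-3)]) (use assms(5) h in \<open>auto simp: car subset_iff\<close>)
  also have "\<dots> = free_lift K N (\<lambda>s. f (h s)) u"
    unfolding free_lift_def
    by (rule N.finsum_cong')
      (use assms(5) h f in \<open>auto simp: car subset_iff linear_map_smult[OF assms(3)]\<close>)
  finally show ?thesis .
qed

lemma free_lift_linear:
  assumes "module K M" "h \<in> S \<rightarrow> carrier M"
  shows "linear_map K (free_module K S) M (free_lift K M h)"
proof -
  interpret module K M by fact
  interpret F: module K "free_module K S" by (rule free_module_module) (rule R.is_cring)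
  note car = carrier_free_module[OF R.is_cring]
  note sup = free_lift_superset[OF assms]
  have h: "h s \<in> carrier M" if "s \<in> S" for s using that assms(2) by auto
  show ?thesis unfolding linear_map_def
  proof (intro conjI ballI)
    show "free_lift K M h \<in> carrier (free_module K S) \<rightarrow> carrier M"
      unfolding free_lift_def by (auto simp: car h subset_iff intro!: M.finsum_closed)
  next
    fix u v assume uv: "u \<in> carrier (free_module K S)" "v \<in> carrier (free_module K S)"
    \<comment> \<open>Cancellation can make the support of the sum of \<open>u\<close> and
      \<open>v\<close> smaller than the union of their supports, so all three sums are taken over
      this union.\<close>
    define A where "A = {p. u p \<noteq> \<zero>\<^bsub>K\<^esub>} \<union> {p. v p \<noteq> \<zero>\<^bsub>K\<^esub>}"
    have A: "finite A" "A \<subseteq> S" using uv by (auto simp: A_def car)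
    have "free_lift K M h (u \<oplus>\<^bsub>free_module K S\<^esub> v)
        = (\<Oplus>\<^bsub>M\<^esub>p\<in>A. (u p \<oplus>\<^bsub>K\<^esub> v p) \<odot>\<^bsub>M\<^esub> h p)"
    proof -
      have "{p. u p \<oplus>\<^bsub>K\<^esub> v p \<noteq> \<zero>\<^bsub>K\<^esub>} \<subseteq> A" by (auto simp: A_def)
      then show ?thesis using sup[OF F.a_closed[OF uv] A(1) _ A(2)] by simp
    qed
    also have "\<dots> = (\<Oplus>\<^bsub>M\<^esub>p\<in>A. u p \<odot>\<^bsub>M\<^esub> h p \<oplus>\<^bsub>M\<^esub> v p \<odot>\<^bsub>M\<^esub> h p)"
      using uv A h by (intro M.finsum_cong') (auto simp: car smult_l_distr subset_iff)
    also have "\<dots> = (\<Oplus>\<^bsub>M\<^esub>p\<in>A. u p \<odot>\<^bsub>M\<^esub> h p) \<oplus>\<^bsub>M\<^esub> (\<Oplus>\<^bsub>M\<^esub>p\<in>A. v p \<odot>\<^bsub>M\<^esub> h p)"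
      using uv A h by (intro M.finsum_addf) (auto simp: car subset_iff)
    also have "\<dots> = free_lift K M h u \<oplus>\<^bsub>M\<^esub> free_lift K M h v"
      using sup[OF uv(1) A(1)] sup[OF uv(2) A(1)] A by (auto simp: A_def)
    finally show "free_lift K M h (u \<oplus>\<^bsub>free_module K S\<^esub> v)
      = free_lift K M h u \<oplus>\<^bsub>M\<^esub> free_lift K M h v" .
  next
    fix c u assume c: "c \<in> carrier K" and u: "u \<in> carrier (free_module K S)"
    \<comment> \<open>Scaling by \<open>c\<close> can shrink the support, so both sums run over the
      support of \<open>u\<close>.\<close>
    define A where "A = {p. u p \<noteq> \<zero>\<^bsub>K\<^esub>}"
    have A: "finite A" "A \<subseteq> S" using u by (auto simp: A_def car)
    have "free_lift K M h (c \<odot>\<^bsub>free_module K S\<^esub> u)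
        = (\<Oplus>\<^bsub>M\<^esub>p\<in>A. (c \<otimes>\<^bsub>K\<^esub> u p) \<odot>\<^bsub>M\<^esub> h p)"
    proof -
      have "{p. c \<otimes>\<^bsub>K\<^esub> u p \<noteq> \<zero>\<^bsub>K\<^esub>} \<subseteq> A" using c by (auto simp: A_def)
      then show ?thesis using sup[OF F.smult_closed[OF c u] A(1) _ A(2)] by simp
    qed
    also have "\<dots> = (\<Oplus>\<^bsub>M\<^esub>p\<in>A. c \<odot>\<^bsub>M\<^esub> (u p \<odot>\<^bsub>M\<^esub> h p))"
      using c u A h by (intro M.finsum_cong') (auto simp: car smult_assoc1 subset_iff)
    also have "\<dots> = c \<odot>\<^bsub>M\<^esub> free_lift K M h u"
      using c u A h unfolding free_lift_def A_def[symmetric]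
      by (intro finsum_smult_ldistr[symmetric]) (auto simp: car subset_iff)
    finally show "free_lift K M h (c \<odot>\<^bsub>free_module K S\<^esub> u) = c \<odot>\<^bsub>M\<^esub> free_lift K M h u" .
  qed
qed

section \<open>Submodules and quotients\<close>

text \<open>Each closure condition passes to an intersection of submodules. Since \<open>S\<close>
  lies in the carrier, the carrier is itself one of the submodules intersected, which keeps the
  intersection inside it.\<close>

lemma (in module) generated_submodule_submodule:
  assumes "S \<subseteq> carrier M"
  shows "submodule (generated_submodule R M S) R M"
proof (rule submoduleI)
  show "generated_submodule R M S \<subseteq> carrier M"
    using assms carrier_is_submodule unfolding generated_submodule_def by blast
  show "\<zero>\<^bsub>M\<^esub> \<in> generated_submodule R M S"
    unfolding generated_submodule_def
    using subgroup.one_closed[OF submodule.axioms(1)] by fastforce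
next
  fix a assume "a \<in> generated_submodule R M S"
  then show "\<ominus>\<^bsub>M\<^esub> a \<in> generated_submodule R M S"
    unfolding generated_submodule_def by (auto dest: submoduleE(3))
next
  fix a b assume "a \<in> generated_submodule R M S" "b \<in> generated_submodule R M S"
  then show "a \<oplus>\<^bsub>M\<^esub> b \<in> generated_submodule R M S"
    unfolding generated_submodule_def by (auto dest: submoduleE(5))
next
  fix c a assume "c \<in> carrier R" "a \<in> generated_submodule R M S"
  then show "c \<odot>\<^bsub>M\<^esub> a \<in> generated_submodule R M S"
    unfolding generated_submodule_def by (auto dest: submoduleE(4))
qed

lemma (in module) generated_submodule_least:
  "submodule N R M \<Longrightarrow> S \<subseteq> N \<Longrightarrow> generated_submodule R M S \<subseteq> N"
  unfolding generated_submodule_def by blast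

lemma generated_submodule_incl: "S \<subseteq> generated_submodule K V S"
  unfolding generated_submodule_def by blast

text \<open>Together with \<open>generated_submodule_least\<close> this reduces vanishing on a
  generated submodule to vanishing on its generators.\<close>

lemma linear_map_kernel_submodule:
  assumes "module K V" "module K W" "linear_map K V W f"
  shows "submodule {x \<in> carrier V. f x = \<zero>\<^bsub>W\<^esub>} K V"
proof -
  interpret V: module K V by fact
  interpret W: module K W by fact
  interpret abelian_group_hom V W f using assms linear_map_abelian_group_hom by blast
  show ?thesis
    by (rule V.submoduleI) (auto simp: linear_map_smult[OF assms(3)])
qed

section \<open>Quotient modules\<close>

lemma (in module) abelian_subgroup_submodule:
  assumes "submodule N R M"
  shows "abelian_subgroup N M"
  by (rule abelian_subgroupI3[OF additive_subgroupI[OF submodule.axioms(1)[OF assms]] M.abelian_group_axioms])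

text \<open>The scalar multiple of a coset is defined as a union over all its elements
  \<open>u\<close>. Each differs from \<open>x\<close> by some \<open>n\<close> in \<open>N\<close>,
  and the multiple of \<open>n\<close> by \<open>c\<close> is again in \<open>N\<close>, so all the
  cosets united are the same one.\<close>

lemma (in module) quotient_smult:
  assumes "submodule N R M" "c \<in> carrier R" "x \<in> carrier M"
  shows "c \<odot>\<^bsub>quotient_module R M N\<^esub> (N +>\<^bsub>M\<^esub> x) = N +>\<^bsub>M\<^esub> (c \<odot>\<^bsub>M\<^esub> x)"
proof -
  interpret N: abelian_subgroup N M using assms(1) by (rule abelian_subgroup_submodule)
  have eq: "N +>\<^bsub>M\<^esub> (c \<odot>\<^bsub>M\<^esub> u) = N +>\<^bsub>M\<^esub> (c \<odot>\<^bsub>M\<^esub> x)" if u: "u \<in> N +>\<^bsub>M\<^esub> x" for u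
  proof -
    obtain n where n: "n \<in> N" "u = n \<oplus>\<^bsub>M\<^esub> x" using u by (auto simp: a_r_coset_def')
    have "c \<odot>\<^bsub>M\<^esub> u = c \<odot>\<^bsub>M\<^esub> n \<oplus>\<^bsub>M\<^esub> c \<odot>\<^bsub>M\<^esub> x"
      using n assms N.a_Hcarr by (simp add: smult_r_distr)
    moreover have "c \<odot>\<^bsub>M\<^esub> n \<in> N" using n assms submoduleE(4) by blast
    ultimately have "c \<odot>\<^bsub>M\<^esub> u \<in> N +>\<^bsub>M\<^esub> (c \<odot>\<^bsub>M\<^esub> x)" by (auto simp: a_r_coset_def')
    then show ?thesis
      using N.a_repr_independence'[OF _ smult_closed[OF assms(2,3)]] by simp
  qed
  have "(\<Union>u\<in>N +>\<^bsub>M\<^esub> x. N +>\<^bsub>M\<^esub> (c \<odot>\<^bsub>M\<^esub> u)) = N +>\<^bsub>M\<^esub> (c \<odot>\<^bsub>M\<^esub> x)"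
    by (rule UN_constant_eq[OF N.a_rcos_self[OF assms(3)]]) (rule ballI, erule eq)
  then show ?thesis by (simp add: quotient_module_def)
qed

lemma (in module) quotient_module_module:
  assumes N: "submodule N R M"
  shows "module R (quotient_module R M N)"
    and "linear_map R M (quotient_module R M N) (\<lambda>x. N +>\<^bsub>M\<^esub> x)"
proof -
  let ?Q = "quotient_module R M N"
  interpret N: abelian_subgroup N M using N by (rule abelian_subgroup_submodule)
  have carI: "N +>\<^bsub>M\<^esub> x \<in> carrier ?Q" if "x \<in> carrier M" for x
    using that unfolding quotient_module_def A_RCOSETS_def' by auto
  have carE: thesis if "T \<in> carrier ?Q" "\<And>x. x \<in> carrier M \<Longrightarrow> T = N +>\<^bsub>M\<^esub> x \<Longrightarrow> thesis" for T thesis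
    using that unfolding quotient_module_def A_RCOSETS_def' by auto
  have add: "(N +>\<^bsub>M\<^esub> x) \<oplus>\<^bsub>?Q\<^esub> (N +>\<^bsub>M\<^esub> y) = N +>\<^bsub>M\<^esub> (x \<oplus>\<^bsub>M\<^esub> y)"
    if "x \<in> carrier M" "y \<in> carrier M" for x y
    using that N.a_rcos_sum by (simp add: quotient_module_def)
  have zero: "\<zero>\<^bsub>?Q\<^esub> = N +>\<^bsub>M\<^esub> \<zero>\<^bsub>M\<^esub>"
    using M.a_coset_add_zero[OF N.a_subset] by (simp add: quotient_module_def)
  note sm = quotient_smult[OF N]
  show "linear_map R M ?Q (\<lambda>x. N +>\<^bsub>M\<^esub> x)"
    unfolding linear_map_def by (auto simp: carI add sm)
  \<comment> \<open>The operations have been computed on representatives, so every module axiom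
    follows from the same axiom in \<open>M\<close>.\<close>
  show "module R ?Q"
  proof (rule moduleI)
    show "abelian_group ?Q"
    proof (rule abelian_groupI)
      fix T assume "T \<in> carrier ?Q"
      then obtain x where x: "x \<in> carrier M" "T = N +>\<^bsub>M\<^esub> x" by (rule carE)
      have "(N +>\<^bsub>M\<^esub> (\<ominus>\<^bsub>M\<^esub> x)) \<oplus>\<^bsub>?Q\<^esub> T = \<zero>\<^bsub>?Q\<^esub>" using x by (simp add: add zero M.l_neg)
      then show "\<exists>y\<in>carrier ?Q. y \<oplus>\<^bsub>?Q\<^esub> T = \<zero>\<^bsub>?Q\<^esub>"
        using x(1) carI by (metis M.a_inv_closed)
    qed (auto elim!: carE simp: add zero carI M.a_ac)
  qed (auto elim!: carE simp: add carI sm smult_l_distr smult_r_distr smult_assoc1 R.is_cring)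
qed

section \<open>Tensor products\<close>

definition bilinear_map ::
  "('k, 'c) ring_scheme \<Rightarrow> ('k, 'v, 'p) module_scheme \<Rightarrow> ('k, 'w, 'q) module_scheme \<Rightarrow>
    ('k, 'm, 'r) module_scheme \<Rightarrow> ('v \<Rightarrow> 'w \<Rightarrow> 'm) \<Rightarrow> bool"
  where "bilinear_map K V W M \<beta> \<longleftrightarrow>
    (\<forall>y\<in>carrier W. linear_map K V M (\<lambda>x. \<beta> x y)) \<and> (\<forall>x\<in>carrier V. linear_map K W M (\<beta> x))"

lemma bilinear_relations_subset:
  assumes "module K V" "module K W"
  shows "bilinear_relations K V W \<subseteq> carrier (free_module K (carrier V \<times> carrier W))"
proof -
  interpret V: module K V by fact
  interpret W: module K W by fact
  interpret F: module K "free_module K (carrier V \<times> carrier W)"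
    by (rule free_module_module) (rule V.R.is_cring)
  have gen: "free_gen K (x, y) \<in> carrier (free_module K (carrier V \<times> carrier W))"
    if "x \<in> carrier V" "y \<in> carrier W" for x y
    by (rule free_gen_closed[OF V.R.is_cring]) (simp add: that)
  show ?thesis unfolding bilinear_relations_def Let_def
    by (auto simp del: free_module_sel intro!: F.minus_closed F.a_closed F.smult_closed gen)
qed

lemma tensor_kernel_submodule:
  assumes "module K V" "module K W"
  shows "submodule (tensor_kernel K V W) K (free_module K (carrier V \<times> carrier W))"
proof -
  interpret V: module K V by fact
  show ?thesis unfolding tensor_kernel_def
    by (rule module.generated_submodule_submodule[OF free_module_module[OF V.R.is_cring]
          bilinear_relations_subset[OF assms]])
qed

lemma tensor_module:
  assumes "module K V" "module K W"
  shows "module K (tensor K V W)"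
    and "linear_map K (free_module K (carrier V \<times> carrier W)) (tensor K V W)
      (\<lambda>u. tensor_kernel K V W +>\<^bsub>free_module K (carrier V \<times> carrier W)\<^esub> u)"
proof -
  interpret V: module K V by fact
  interpret F: module K "free_module K (carrier V \<times> carrier W)"
    by (rule free_module_module) (rule V.R.is_cring)
  show "module K (tensor K V W)"
    "linear_map K (free_module K (carrier V \<times> carrier W)) (tensor K V W)
      (\<lambda>u. tensor_kernel K V W +>\<^bsub>free_module K (carrier V \<times> carrier W)\<^esub> u)"
    unfolding tensor_def using F.quotient_module_module[OF tensor_kernel_submodule[OF assms]] by auto
qed

lemma carrier_tensor:
  "carrier (tensor K V W) = (\<lambda>u. tensor_kernel K V W +>\<^bsub>free_module K (carrier V \<times> carrier W)\<^esub> u) `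
    carrier (free_module K (carrier V \<times> carrier W))"
  unfolding tensor_def quotient_module_def A_RCOSETS_def' by auto

text \<open>The generators of the tensor kernel are exactly the differences of the two sides of the
  bilinearity laws, so each law becomes an equality of two cosets, supplied by
  \<open>rel\<close>.\<close>

lemma pure_tensor_bilinear:
  assumes "module K V" "module K W"
  shows "bilinear_map K V W (tensor K V W) (pure_tensor K V W)"
proof -
  interpret V: module K V by fact
  interpret W: module K W by fact
  let ?F = "free_module K (carrier V \<times> carrier W)" and ?N = "tensor_kernel K V W"
  interpret F: module K ?F by (rule free_module_module) (rule V.R.is_cring)
  interpret N: abelian_subgroup ?N ?F
    by (rule F.abelian_subgroup_submodule[OF tensor_kernel_submodule[OF assms]])
  note [simp del] = free_module_sel
  note lin = tensor_module(2)[OF assms]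
  have gen: "free_gen K (x, y) \<in> carrier ?F" if "x \<in> carrier V" "y \<in> carrier W" for x y
    by (rule free_gen_closed[OF V.R.is_cring]) (simp add: that)
  have pure: "pure_tensor K V W x y \<in> carrier (tensor K V W)" if "x \<in> carrier V" "y \<in> carrier W" for x y
    using linear_map_closed[OF lin gen[OF that]] by (simp add: pure_tensor_def)
  have rel: "?N +>\<^bsub>?F\<^esub> u = ?N +>\<^bsub>?F\<^esub> v"
    if "u \<ominus>\<^bsub>?F\<^esub> v \<in> bilinear_relations K V W" "u \<in> carrier ?F" "v \<in> carrier ?F" for u v
  proof -
    have "u \<ominus>\<^bsub>?F\<^esub> v \<in> ?N"
      unfolding tensor_kernel_def by (rule subsetD[OF generated_submodule_incl that(1)])
    then have "u \<in> ?N +>\<^bsub>?F\<^esub> v"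
      using N.a_rcos_module_rev[OF that(3,2)] by (simp add: a_minus_def)
    then show ?thesis using N.a_repr_independence'[OF _ that(3)] by simp
  qed
  note relD = bilinear_relations_def[of K V W, unfolded Let_def]
  have "pure_tensor K V W (x \<oplus>\<^bsub>V\<^esub> x') y
      = pure_tensor K V W x y \<oplus>\<^bsub>tensor K V W\<^esub> pure_tensor K V W x' y"
    if "x \<in> carrier V" "x' \<in> carrier V" "y \<in> carrier W" for x x' y
  proof -
    have "?N +>\<^bsub>?F\<^esub> free_gen K (x \<oplus>\<^bsub>V\<^esub> x', y)
        = ?N +>\<^bsub>?F\<^esub> (free_gen K (x, y) \<oplus>\<^bsub>?F\<^esub> free_gen K (x', y))"
      by (rule rel) (use that in \<open>auto simp: relD gen\<close>)
    then show ?thesis using linear_map_add[OF lin] gen that by (simp add: pure_tensor_def)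
  qed
  moreover have "pure_tensor K V W x (y \<oplus>\<^bsub>W\<^esub> y')
      = pure_tensor K V W x y \<oplus>\<^bsub>tensor K V W\<^esub> pure_tensor K V W x y'"
    if "x \<in> carrier V" "y \<in> carrier W" "y' \<in> carrier W" for x y y'
  proof -
    have "?N +>\<^bsub>?F\<^esub> free_gen K (x, y \<oplus>\<^bsub>W\<^esub> y')
        = ?N +>\<^bsub>?F\<^esub> (free_gen K (x, y) \<oplus>\<^bsub>?F\<^esub> free_gen K (x, y'))"
      by (rule rel) (use that in \<open>auto simp: relD gen\<close>)
    then show ?thesis using linear_map_add[OF lin] gen that by (simp add: pure_tensor_def)
  qed
  moreover have "pure_tensor K V W (c \<odot>\<^bsub>V\<^esub> x) y = c \<odot>\<^bsub>tensor K V W\<^esub> pure_tensor K V W x y"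
    "pure_tensor K V W x (c \<odot>\<^bsub>W\<^esub> y) = c \<odot>\<^bsub>tensor K V W\<^esub> pure_tensor K V W x y"
    if "c \<in> carrier K" "x \<in> carrier V" "y \<in> carrier W" for c x y
  proof -
    have "?N +>\<^bsub>?F\<^esub> free_gen K (c \<odot>\<^bsub>V\<^esub> x, y) = ?N +>\<^bsub>?F\<^esub> (c \<odot>\<^bsub>?F\<^esub> free_gen K (x, y))"
      "?N +>\<^bsub>?F\<^esub> free_gen K (x, c \<odot>\<^bsub>W\<^esub> y) = ?N +>\<^bsub>?F\<^esub> (c \<odot>\<^bsub>?F\<^esub> free_gen K (x, y))"
      by (rule rel; use that in \<open>auto simp: relD gen\<close>)+
    then show "pure_tensor K V W (c \<odot>\<^bsub>V\<^esub> x) y = c \<odot>\<^bsub>tensor K V W\<^esub> pure_tensor K V W x y"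
      "pure_tensor K V W x (c \<odot>\<^bsub>W\<^esub> y) = c \<odot>\<^bsub>tensor K V W\<^esub> pure_tensor K V W x y"
      using linear_map_smult[OF lin] gen that by (simp_all add: pure_tensor_def)
  qed
  ultimately show ?thesis
    unfolding bilinear_map_def linear_map_def using pure by auto
qed

section \<open>The universal property of the tensor product\<close>

lemma bilinear_map_closed:
  "bilinear_map K V W M \<beta> \<Longrightarrow> x \<in> carrier V \<Longrightarrow> y \<in> carrier W \<Longrightarrow> \<beta> x y \<in> carrier M"
  unfolding bilinear_map_def by (blast dest: linear_map_closed)

text \<open>Bilinearity of \<open>\<beta>\<close> says that its linear extension kills every
  bilinear relation. The kernel of this extension is a submodule, so it contains the submodule that
  the relations generate.\<close>

lemma free_lift_tensor_kernel:
  assumes "module K V" "module K W" "module K M" "bilinear_map K V W M \<beta>"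
    and "n \<in> tensor_kernel K V W"
  shows "free_lift K M (\<lambda>p. \<beta> (fst p) (snd p)) n = \<zero>\<^bsub>M\<^esub>"
proof -
  interpret V: module K V by fact
  interpret W: module K W by fact
  interpret M: module K M by fact
  let ?F = "free_module K (carrier V \<times> carrier W)" and ?h = "\<lambda>p. \<beta> (fst p) (snd p)"
  interpret F: module K ?F by (rule free_module_module) (rule V.R.is_cring)
  note [simp del] = free_module_sel
  have h: "?h \<in> carrier V \<times> carrier W \<rightarrow> carrier M"
    using bilinear_map_closed[OF assms(4)] by auto
  note lin = free_lift_linear[OF assms(3) h]
  interpret \<phi>: abelian_group_hom ?F M "free_lift K M ?h"
    by (rule linear_map_abelian_group_hom[OF F.module_axioms assms(3) lin])
  have gen: "free_gen K (x, y) \<in> carrier ?F" if "x \<in> carrier V" "y \<in> carrier W" for x y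
    by (rule free_gen_closed[OF V.R.is_cring]) (simp add: that)
  have val: "free_lift K M ?h (free_gen K (x, y)) = \<beta> x y" if "x \<in> carrier V" "y \<in> carrier W" for x y
    using free_lift_gen[OF assms(3) h, of "(x, y)"] that by simp
  have \<beta>: "linear_map K V M (\<lambda>x. \<beta> x y)" if "y \<in> carrier W" for y
    using assms(4) that by (simp add: bilinear_map_def)
  have \<beta>': "linear_map K W M (\<beta> x)" if "x \<in> carrier V" for x
    using assms(4) that by (simp add: bilinear_map_def)
  have "bilinear_relations K V W \<subseteq> {u \<in> carrier ?F. free_lift K M ?h u = \<zero>\<^bsub>M\<^esub>}"
    using bilinear_relations_subset[OF assms(1,2)]
    by (auto simp: bilinear_relations_def Let_def a_minus_def gen val M.r_neg
        bilinear_map_closed[OF assms(4)] linear_map_smult[OF lin]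
        linear_map_add[OF \<beta>] linear_map_add[OF \<beta>'] linear_map_smult[OF \<beta>] linear_map_smult[OF \<beta>'])
  then show ?thesis
    using F.generated_submodule_least[OF linear_map_kernel_submodule[OF F.module_axioms assms(3) lin]] assms(5)
    unfolding tensor_kernel_def by blast
qed

text \<open>The representative picked by \<open>SOME\<close> is \<open>u\<close> plus some
  \<open>n\<close> in the tensor kernel, and the linear extension of \<open>\<beta>\<close> vanishes
  at \<open>n\<close>. From here on tensor maps can be computed on any convenient
  representative.\<close>

lemma tensor_lift_coset:
  assumes "module K V" "module K W" "module K M" "bilinear_map K V W M \<beta>"
    and u: "u \<in> carrier (free_module K (carrier V \<times> carrier W))"
  shows "tensor_lift K M \<beta> (tensor_kernel K V W +>\<^bsub>free_module K (carrier V \<times> carrier W)\<^esub> u)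
    = free_lift K M (\<lambda>p. \<beta> (fst p) (snd p)) u"
proof -
  interpret V: module K V by fact
  interpret M: module K M by fact
  let ?F = "free_module K (carrier V \<times> carrier W)" and ?h = "\<lambda>p. \<beta> (fst p) (snd p)"
  let ?N = "tensor_kernel K V W"
  interpret F: module K ?F by (rule free_module_module) (rule V.R.is_cring)
  interpret N: abelian_subgroup ?N ?F
    by (rule F.abelian_subgroup_submodule[OF tensor_kernel_submodule[OF assms(1,2)]])
  have h: "?h \<in> carrier V \<times> carrier W \<rightarrow> carrier M"
    using bilinear_map_closed[OF assms(4)] by auto
  note lin = free_lift_linear[OF assms(3) h]
  have "(SOME v. v \<in> ?N +>\<^bsub>?F\<^esub> u) \<in> ?N +>\<^bsub>?F\<^esub> u"
    by (rule someI[where P = "\<lambda>v. v \<in> ?N +>\<^bsub>?F\<^esub> u"]) (rule N.a_rcos_self[OF u])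
  then obtain n where n: "n \<in> ?N" "(SOME v. v \<in> ?N +>\<^bsub>?F\<^esub> u) = n \<oplus>\<^bsub>?F\<^esub> u"
    unfolding a_r_coset_def' by blast
  then have "tensor_lift K M \<beta> (?N +>\<^bsub>?F\<^esub> u) = free_lift K M ?h (n \<oplus>\<^bsub>?F\<^esub> u)"
    unfolding tensor_lift_def free_lift_def Let_def by simp
  also have "\<dots> = free_lift K M ?h n \<oplus>\<^bsub>M\<^esub> free_lift K M ?h u"
    using linear_map_add[OF lin N.a_Hcarr[OF n(1)] u] .
  also have "\<dots> = free_lift K M ?h u"
    using free_lift_tensor_kernel[OF assms(1-4) n(1)] linear_map_closed[OF lin u] by simp
  finally show ?thesis .
qed

lemma tensor_lift_pure:
  assumes "module K V" "module K W" "module K M" "bilinear_map K V W M \<beta>"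
    and "x \<in> carrier V" "y \<in> carrier W"
  shows "tensor_lift K M \<beta> (pure_tensor K V W x y) = \<beta> x y"
proof -
  interpret V: module K V by fact
  have "(\<lambda>p. \<beta> (fst p) (snd p)) \<in> carrier V \<times> carrier W \<rightarrow> carrier M"
    using bilinear_map_closed[OF assms(4)] by auto
  then show ?thesis unfolding pure_tensor_def
    using tensor_lift_coset[OF assms(1-4) free_gen_closed[OF V.R.is_cring]] assms(5,6)
      free_lift_gen[OF assms(3), of _ _ "(x, y)"] by force
qed

text \<open>Every tensor is a coset, and the projection \<open>?\<pi>\<close> is linear, so
  linearity descends from \<open>free_lift\<close>.\<close>

lemma tensor_lift_linear:
  assumes "module K V" "module K W" "module K M" "bilinear_map K V W M \<beta>"
  shows "linear_map K (tensor K V W) M (tensor_lift K M \<beta>)"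
proof -
  interpret V: module K V by fact
  let ?F = "free_module K (carrier V \<times> carrier W)" and ?h = "\<lambda>p. \<beta> (fst p) (snd p)"
  let ?\<pi> = "\<lambda>u. tensor_kernel K V W +>\<^bsub>?F\<^esub> u"
  interpret F: module K ?F by (rule free_module_module) (rule V.R.is_cring)
  note [simp del] = free_module_sel
  have h: "?h \<in> carrier V \<times> carrier W \<rightarrow> carrier M"
    using bilinear_map_closed[OF assms(4)] by auto
  note lin = free_lift_linear[OF assms(3) h]
  note \<pi> = tensor_module(2)[OF assms(1,2)]
  note coset = tensor_lift_coset[OF assms]
  have "?\<pi> u \<oplus>\<^bsub>tensor K V W\<^esub> ?\<pi> v = ?\<pi> (u \<oplus>\<^bsub>?F\<^esub> v)" if "u \<in> carrier ?F" "v \<in> carrier ?F" for u v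
    using linear_map_add[OF \<pi> that] by simp
  moreover have "c \<odot>\<^bsub>tensor K V W\<^esub> ?\<pi> u = ?\<pi> (c \<odot>\<^bsub>?F\<^esub> u)" if "c \<in> carrier K" "u \<in> carrier ?F" for c u
    using linear_map_smult[OF \<pi> that] by simp
  ultimately show ?thesis
    unfolding linear_map_def carrier_tensor
    by (auto simp: coset linear_map_closed[OF lin] linear_map_add[OF lin] linear_map_smult[OF lin])
qed

section \<open>Functoriality of the tensor product\<close>

lemma bilinear_map_linear_comp:
  assumes "bilinear_map K V W M \<beta>" "linear_map K V' V f" "linear_map K W' W g"
  shows "bilinear_map K V' W' M (\<lambda>x y. \<beta> (f x) (g y))"
  using assms(1) linear_map_closed[OF assms(2)] linear_map_closed[OF assms(3)]
  unfolding bilinear_map_def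
  by (auto intro: linear_map_comp[OF assms(2)] linear_map_comp[OF assms(3)])

text \<open>Both sides are linear combinations with the coefficients of one representative of
  \<open>t\<close>, so it suffices to compare them on pure tensors. The maps \<open>h\<close> and
  \<open>h'\<close> need agree with the composites only on the carriers, because composites of
  morphisms are formed by \<open>compose\<close> and are undefined elsewhere.\<close>

lemma tensor_map_comp:
  assumes "module K U" "module K V" "module K W" "module K U'" "module K V'" "module K W'"
    and f: "linear_map K U V f" "linear_map K U' V' f'"
    and g: "linear_map K V W g" "linear_map K V' W' g'"
    and h: "\<And>x. x \<in> carrier U \<Longrightarrow> h x = g (f x)" "\<And>x. x \<in> carrier U' \<Longrightarrow> h' x = g' (f' x)"
    and t: "t \<in> carrier (tensor K U U')"
  shows "tensor_map K W W' h h' t = tensor_map K W W' g g' (tensor_map K V V' f f' t)"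
proof -
  interpret U: module K U by fact
  interpret VV: module K "tensor K V V'" by (rule tensor_module) fact+
  interpret WW: module K "tensor K W W'" by (rule tensor_module) fact+
  let ?F = "free_module K (carrier U \<times> carrier U')"
  note pV = pure_tensor_bilinear[OF assms(2,5)]
  note pW = pure_tensor_bilinear[OF assms(3,6)]
  note bf = bilinear_map_linear_comp[OF pV f]
  note bg = bilinear_map_linear_comp[OF pW g]
  let ?G = "tensor_map K W W' g g'"
  have G: "linear_map K (tensor K V V') (tensor K W W') ?G"
    unfolding tensor_map_def by (rule tensor_lift_linear[OF assms(2,5) WW.module_axioms bg])
  obtain u where u: "u \<in> carrier ?F" "t = tensor_kernel K U U' +>\<^bsub>?F\<^esub> u"
    using t unfolding carrier_tensor by blast
  have lh: "linear_map K U W h" "linear_map K U' W' h'"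
    using linear_map_cong[OF assms(1) linear_map_comp[OF f(1) g(1)], of h]
      linear_map_cong[OF assms(4) linear_map_comp[OF f(2) g(2)], of h'] h by auto
  note bh = bilinear_map_linear_comp[OF pW lh]
  have "?G (tensor_map K V V' f f' t)
      = ?G (free_lift K (tensor K V V') (\<lambda>p. pure_tensor K V V' (f (fst p)) (f' (snd p))) u)"
    unfolding tensor_map_def[of K V V'] u(2)
    by (subst tensor_lift_coset[OF assms(1,4) VV.module_axioms bf u(1)]) (rule refl)
  \<comment> \<open>The second map is linear, so it passes through the linear combination.\<close>
  also have "\<dots> = free_lift K (tensor K W W')
      (\<lambda>p. ?G (pure_tensor K V V' (f (fst p)) (f' (snd p)))) u"
    by (rule linear_map_free_lift[OF VV.module_axioms WW.module_axioms G _ u(1)])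
      (use bilinear_map_closed[OF bf] in auto)
  also have "\<dots> = free_lift K (tensor K W W') (\<lambda>p. pure_tensor K W W' (h (fst p)) (h' (snd p))) u"
  proof -
    \<comment> \<open>On a pure tensor \<open>tensor_lift\<close> takes the value of its bilinear
      map, here the pure tensor of \<open>g (f x)\<close> and \<open>g' (f' y)\<close>.\<close>
    have "?G (pure_tensor K V V' (f x) (f' y)) = pure_tensor K W W' (h x) (h' y)"
      if "x \<in> carrier U" "y \<in> carrier U'" for x y
      unfolding tensor_map_def
      by (subst tensor_lift_pure[OF assms(2,5) WW.module_axioms bg])
        (use that f h in \<open>auto simp: linear_map_closed\<close>)
    then show ?thesis
      unfolding free_lift_def using u(1) bilinear_map_closed[OF bh]
      by (intro WW.finsum_cong') (auto simp: carrier_free_module[OF U.R.is_cring] subset_iff)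
  qed
  also have "\<dots> = tensor_map K W W' h h' t"
    unfolding tensor_map_def u(2)
    by (subst tensor_lift_coset[OF assms(1,4) WW.module_axioms bh u(1)]) (rule refl)
  finally show ?thesis by (rule sym)
qed

section \<open>Composition of morphisms\<close>

text \<open>For the comultiplication, use compatibility of \<open>g\<close> at \<open>f x\<close>,
  then that of \<open>f\<close> at \<open>x\<close>, and merge the two tensor maps by
  \<open>tensor_map_comp\<close>. The counit condition simply chains.\<close>

lemma coalgebra_hom_compose:
  assumes C: "is_coalgebra K C" and D: "is_coalgebra K D" and E: "is_coalgebra K E"
    and f: "coalgebra_hom K C D f" and g: "coalgebra_hom K D E g"
  shows "coalgebra_hom K C E (compose (carrier C) g f)"
proof -
  have mod: "module K C" "module K D" "module K E"
    using C D E unfolding is_coalgebra_def by auto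
  have lin: "linear_map K C D f" "linear_map K D E g"
    using f g unfolding coalgebra_hom_def by auto
  have comult: "comult C x \<in> carrier (tensor K C C)" if "x \<in> carrier C" for x
    using C that linear_map_closed unfolding is_coalgebra_def by fast
  have "linear_map K C E (compose (carrier C) g f)"
    by (rule linear_map_cong[OF mod(1) linear_map_comp[OF lin]]) (simp add: compose_def)
  moreover have "comult E (compose (carrier C) g f x)
      = tensor_map K E E (compose (carrier C) g f) (compose (carrier C) g f) (comult C x) \<and>
      counit E (compose (carrier C) g f x) = counit C x" if x: "x \<in> carrier C" for x
  proof -
    have "tensor_map K E E (compose (carrier C) g f) (compose (carrier C) g f) (comult C x)
        = tensor_map K E E g g (tensor_map K D D f f (comult C x))"
      by (rule tensor_map_comp[OF mod mod lin(1,1) lin(2,2) _ _ comult[OF x]])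
        (simp_all add: compose_def)
    then show ?thesis
      using f g x linear_map_closed[OF lin(1) x] by (simp add: coalgebra_hom_def compose_def)
  qed
  ultimately show ?thesis unfolding coalgebra_hom_def by blast
qed

text \<open>The algebra structure of \<open>A\<close> puts the unit and all products in the carrier,
  where \<open>compose\<close> agrees with the composite.\<close>

lemma algebra_hom_compose:
  assumes A: "unital_algebra K A"
    and f: "algebra_hom K A B f" and g: "algebra_hom K B C g"
  shows "algebra_hom K A C (compose (carrier A) g f)"
proof -
  have mod: "module K A" and "ring A" using A unfolding unital_algebra_def by auto
  interpret A: ring A by fact
  have lin: "linear_map K A B f" "linear_map K B C g"
    using f g unfolding algebra_hom_def by auto
  have "linear_map K A C (compose (carrier A) g f)"
    by (rule linear_map_cong[OF mod linear_map_comp[OF lin]]) (simp add: compose_def)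
  then show ?thesis
    using f g linear_map_closed[OF lin(1)] by (simp add: algebra_hom_def compose_def)
qed

section \<open>Morphisms of 2-bialgebras\<close>

lemma carrier_second [simp]: "carrier (second A) = carrier A"
  by (simp add: second_def)

lemma two_bialgebra_hom_compose:
  assumes "is_two_bialgebra K A" "is_two_bialgebra K B" "is_two_bialgebra K C"
    and f: "f \<in> two_bialgebra_hom K A B" and g: "g \<in> two_bialgebra_hom K B C"
  shows "compose (carrier A) g f \<in> two_bialgebra_hom K A C"
proof -
  have "is_coalgebra K A" "is_coalgebra K B" "is_coalgebra K C"
    and A: "unital_algebra K A" "unital_algebra K (second A)"
    using assms(1-3) unfolding is_two_bialgebra_def is_bialgebra_def by auto
  then have "coalgebra_hom K A C (compose (carrier A) g f)"
    using f g unfolding two_bialgebra_hom_def by (auto intro: coalgebra_hom_compose)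
  moreover have "algebra_hom K A C (compose (carrier A) g f)"
    using f g algebra_hom_compose[OF A(1)] unfolding two_bialgebra_hom_def by blast
  \<comment> \<open>Both multiplications live on the same carrier, so the restricted composite is
    the same function for either structure.\<close>
  moreover have "algebra_hom K (second A) (second C) (compose (carrier A) g f)"
    using f g algebra_hom_compose[OF A(2), of "second B" f "second C" g]
    unfolding two_bialgebra_hom_def by simp
  ultimately show ?thesis unfolding two_bialgebra_hom_def by simp
qed

lemma two_bialgebra_hom_closed:
  "f \<in> two_bialgebra_hom K A B \<Longrightarrow> f \<in> carrier A \<rightarrow> carrier B"
  unfolding two_bialgebra_hom_def coalgebra_hom_def linear_map_def by auto

section \<open>Coproducts\<close>

text \<open>Maps from \<open>H\<close> to \<open>Y\<close> correspond to maps from \<open>B\<close>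
  to \<open>Y\<close> by composition with \<open>i\<close>, and these to cocones by composition with
  the \<open>q l\<close>. Taking \<open>D\<close> to be any part of \<open>C\<close> with the same
  morphisms and composition lets one argument serve the general and the cocommutative case. Closure
  and associativity are hypotheses because a \<open>category\<close> record carries no
  axioms.\<close>

lemma coproduct_along_forgetful:
  fixes C D :: "(('k, 'a) two_bialgebra, 'a \<Rightarrow> 'a) category"
  assumes sub: "Obj D \<subseteq> Obj C" "Hom D = Hom C" "Comp D = Comp C"
    and closed: "\<And>X Y Z f g. X \<in> Obj C \<Longrightarrow> Y \<in> Obj C \<Longrightarrow> Z \<in> Obj C \<Longrightarrow>
      f \<in> Hom C X Y \<Longrightarrow> g \<in> Hom C Y Z \<Longrightarrow> Comp C X Y Z g f \<in> Hom C X Z"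
    and assoc: "\<And>W X Y Z f g h. f \<in> Hom C W X \<Longrightarrow> g \<in> Hom C X Y \<Longrightarrow> h \<in> Hom C Y Z \<Longrightarrow>
      Comp C W Y Z h (Comp C W X Y g f) = Comp C W X Z (Comp C X Y Z h g) f"
    and Xs: "\<forall>l\<in>I. Xs l \<in> Obj D"
    and cop: "is_coproduct C I (\<lambda>l. fobj forgetful (Xs l)) B q"
    and univ: "universal_arrow D C forgetful B H i"
  shows "is_coproduct D I Xs H
    (\<lambda>l. Comp C (fobj forgetful (Xs l)) B (fobj forgetful H) i (q l))"
proof -
  have B: "B \<in> Obj C" and q: "\<And>l. l \<in> I \<Longrightarrow> q l \<in> Hom C (Xs l) B"
    and cop_ex1: "\<And>Y f. Y \<in> Obj C \<Longrightarrow> \<forall>l\<in>I. f l \<in> Hom C (Xs l) Y \<Longrightarrow>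
      \<exists>!h. h \<in> Hom C B Y \<and> (\<forall>l\<in>I. Comp C (Xs l) B Y h (q l) = f l)"
    using cop unfolding is_coproduct_def forgetful_def cat_functor.simps by blast+
  have H: "H \<in> Obj D" and i: "i \<in> Hom C B H"
    and univ_ex1: "\<And>L g. L \<in> Obj D \<Longrightarrow> g \<in> Hom C B L \<Longrightarrow>
      \<exists>!f. f \<in> Hom C H L \<and> Comp C B H L f i = g"
    using univ unfolding universal_arrow_def forgetful_def cat_functor.simps sub(2) by blast+
  have HC: "H \<in> Obj C" and XC: "\<And>l. l \<in> I \<Longrightarrow> Xs l \<in> Obj C" using H Xs sub(1) by auto
  have "\<exists>!h. h \<in> Hom C H Y \<and> (\<forall>l\<in>I. Comp C (Xs l) H Y h (Comp C (Xs l) B H i (q l)) = f l)"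
    if Y: "Y \<in> Obj D" and f: "\<forall>l\<in>I. f l \<in> Hom C (Xs l) Y" for Y f
  proof -
    have YC: "Y \<in> Obj C" using Y sub(1) by auto
    \<comment> \<open>Restricting \<open>h\<close> along the new injections is the same as
      restricting \<open>h \<circ> i\<close> along the \<open>q l\<close>. Existence and uniqueness
      both rest on this.\<close>
    have eq: "Comp C (Xs l) H Y h (Comp C (Xs l) B H i (q l))
        = Comp C (Xs l) B Y (Comp C B H Y h i) (q l)" if "l \<in> I" "h \<in> Hom C H Y" for l h
      using assoc[OF q[OF that(1)] i that(2)] .
    obtain k where k: "k \<in> Hom C B Y" "\<forall>l\<in>I. Comp C (Xs l) B Y k (q l) = f l"
      using cop_ex1[OF YC f] by blast
    obtain h where h: "h \<in> Hom C H Y" "Comp C B H Y h i = k"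
      using univ_ex1[OF Y k(1)] by blast
    show ?thesis
    proof (rule ex1I)
      show "h \<in> Hom C H Y \<and> (\<forall>l\<in>I. Comp C (Xs l) H Y h (Comp C (Xs l) B H i (q l)) = f l)"
        using h k(2) eq by auto
    next
      fix h' assume h': "h' \<in> Hom C H Y \<and>
        (\<forall>l\<in>I. Comp C (Xs l) H Y h' (Comp C (Xs l) B H i (q l)) = f l)"
      \<comment> \<open>A competitor \<open>h'\<close> gives a second mediating map out of
        \<open>B\<close>. By the coproduct property it equals \<open>k\<close>, and then
        universality of \<open>i\<close> forces \<open>h'\<close> to be \<open>h\<close>.\<close>
      have "Comp C B H Y h' i \<in> Hom C B Y \<and>
          (\<forall>l\<in>I. Comp C (Xs l) B Y (Comp C B H Y h' i) (q l) = f l)"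
        using closed[OF B HC YC i] h' eq by auto
      then have "Comp C B H Y h' i = k" using cop_ex1[OF YC f] k by blast
      then show "h' = h" using univ_ex1[OF Y k(1)] h h' by blast
    qed
  qed
  then show ?thesis
    unfolding is_coproduct_def sub(2,3) using H Xs closed[OF XC B HC q i] by (simp add: forgetful_def)
qed

theorem mainTheorem9:
  fixes K :: "'k ring"
    and I :: "'i set"
    and Hs :: "'i \<Rightarrow> ('k, 'a) two_bialgebra"
    and B H :: "('k, 'a) two_bialgebra"
    and q :: "'i \<Rightarrow> 'a \<Rightarrow> 'a"
    and i :: "'a \<Rightarrow> 'a"
  assumes "field K"
  shows
    "((\<forall>l\<in>I. Hs l \<in> Obj (two_Halg K)) \<and>
      is_coproduct (two_Bialg K) I (\<lambda>l. fobj forgetful (Hs l)) B q \<and>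
      universal_arrow (two_Halg K) (two_Bialg K) forgetful B H i \<longrightarrow>
      is_coproduct (two_Halg K) I Hs H
        (\<lambda>l. Comp (two_Bialg K) (fobj forgetful (Hs l)) B (fobj forgetful H) i (q l))) \<and>
     ((\<forall>l\<in>I. Hs l \<in> Obj (two_Halg_coc K)) \<and>
      is_coproduct (two_Bialg_coc K) I (\<lambda>l. fobj forgetful (Hs l)) B q \<and>
      universal_arrow (two_Halg_coc K) (two_Bialg_coc K) forgetful B H i \<longrightarrow>
      is_coproduct (two_Halg_coc K) I Hs H
        (\<lambda>l. Comp (two_Bialg_coc K) (fobj forgetful (Hs l)) B (fobj forgetful H) i (q l)))"
proof -
  \<comment> \<open>Since \<open>compose\<close> restricts its result, the inner composite of
    \<open>h\<close> and \<open>g\<close> has its expected values only on the carrier of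
    \<open>X\<close>; \<open>f\<close> lands there.\<close>
  have assoc: "compose (carrier W) h (compose (carrier W) g f)
      = compose (carrier W) (compose (carrier X) h g) f"
    if "f \<in> two_bialgebra_hom K W X" for W X :: "('k, 'a) two_bialgebra" and f g h :: "'a \<Rightarrow> 'a"
    using compose_assoc[OF two_bialgebra_hom_closed[OF that], of h g] .
  note defs = two_Bialg_coc_def two_Halg_coc_def full_subcategory_def two_Bialg_def two_Halg_def
  show ?thesis
  proof (intro conjI impI; elim conjE)
    assume "\<forall>l\<in>I. Hs l \<in> Obj (two_Halg K)"
      "is_coproduct (two_Bialg K) I (\<lambda>l. fobj forgetful (Hs l)) B q"
      "universal_arrow (two_Halg K) (two_Bialg K) forgetful B H i"
    then show "is_coproduct (two_Halg K) I Hs H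
        (\<lambda>l. Comp (two_Bialg K) (fobj forgetful (Hs l)) B (fobj forgetful H) i (q l))"
      \<comment> \<open>What remains is that a 2-Hopf algebra is a 2-bialgebra, that both categories
        share morphisms and composition, and that composition is closed and associative.\<close>
      by (rule coproduct_along_forgetful[rotated -3])
        (auto simp: defs is_two_hopf_def assoc[symmetric] intro: two_bialgebra_hom_compose)
  next
    assume "\<forall>l\<in>I. Hs l \<in> Obj (two_Halg_coc K)"
      "is_coproduct (two_Bialg_coc K) I (\<lambda>l. fobj forgetful (Hs l)) B q"
      "universal_arrow (two_Halg_coc K) (two_Bialg_coc K) forgetful B H i"
    \<comment> \<open>Cocommutativity cuts down the objects of both categories by the same condition
      and leaves morphisms and composition as they were.\<close>
    then show "is_coproduct (two_Halg_coc K) I Hs H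
        (\<lambda>l. Comp (two_Bialg_coc K) (fobj forgetful (Hs l)) B (fobj forgetful H) i (q l))"
      by (rule coproduct_along_forgetful[rotated -3])
        (auto simp: defs is_two_hopf_def assoc[symmetric] intro: two_bialgebra_hom_compose)
  qed
qed

end
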